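(* For all integers $n\geq 0$ the following identities hold (the first as formal power series in $x$ whose coefficients are polynomials in $p,q$, the second as rational functions in $s,t$): (a) $\displaystyle G_{n+1}(p,q,x) = \frac{p}{p-q}\left[ G_n(q,p,x) - G_n(q,q,x) \right]$; (b) $\displaystyle U_{n+1}(s,t) = \frac{1-t}{s-t}\left[ \left(\frac{1-t}{1-s}\right)^{n+1} s\,U_n(t,s) - t\,U_n(t,t) \right]$.
   Context: For $n\geq1$, the zig-zag poset $Z_n$ is the poset on $[n]=\{1,\dots,n\}$ generated by the relations $j<_{Z_n} j+1$ for odd $j\in[n-1]$ and $j>_{Z_n} j+1$ for even $j\in[n-1]$. Let $\mathcal{A}_n(m)$ be the set of functions $f:[n]\to\{1,\dots,m\}$ with $f(j)\leq f(j+1)$ for odd $j\in[n-1]$ and $f(j)\geq f(j+1)$ for even $j\in[n-1]$ (bounded relaxed $Z_n$-partitions). For $n\ge1$, $m\ge1$ put $\Omega_n(p,q;m)=\sum_{f\in\mathcal{A}_n(m)} p^{f(1)}q^{m+1-f(1)}$, and define $G_n(p,q,x)=\sum_{m\geq1}\Omega_n(p,q;m)x^m$ for $n\geq1$, with $G_0(p,q,x)=pqx/(1-qx)$. For a permutation $w\in S_n$, $\mathrm{Ret}_1(w)=\{\,i\in[n-1] : w^{-1}(i)>w^{-1}(i+1)+1\,\}$ is the set of big returns. Let $U_n$ be the set of up-down alternating permutations $u\in S_n$, i.e. $u(1)<u(2)>u(3)<\cdots$. For $u\in U_n$ let $\mathrm{ret}_1^-(u)=|\mathrm{Ret}_1(u)\cap\{1,\dots,u(1)\}|$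 and $\mathrm{ret}_1^+(u)=|\mathrm{Ret}_1(u)\cap\{u(1)+1,\dots,n-1\}|$. For $n\geq1$ define $U_n(s,t)=\sum_{u\in U_n} s^{\mathrm{ret}_1^-(u)}t^{\mathrm{ret}_1^+(u)}\left(\frac{1-t}{1-s}\right)^{u(1)}$, and $U_0(s,t)=1$. *)

theory Defs
  imports
    "HOL-Combinatorics.Permutations"
    "HOL-Library.FuncSet"
    "HOL-Computational_Algebra.Computational_Algebra"
begin

type_synonym ratfun2 = "rat poly poly fract"

definition indet1 :: ratfun2 where
  "indet1 = to_fract [:[:0, 1:]:]"

definition indet2 :: ratfun2 where
  "indet2 = to_fract [:0, 1:]"

text \<open>
  The polynomials and rational functions below are defined by evaluating their defining
  formulas at elements of a field. Evaluation at the indeterminates gives the objects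
  themselves, and exchanging or identifying the indeterminates is evaluation at the
  corresponding elements.
\<close>

definition relaxed_partitions :: "nat \<Rightarrow> nat \<Rightarrow> (nat \<Rightarrow> nat) set" where
  "relaxed_partitions n m =
     {f \<in> {1..n} \<rightarrow>\<^sub>E {1..m}.
        \<forall>j\<in>{1..<n}. (odd j \<longrightarrow> f j \<le> f (j + 1)) \<and> (even j \<longrightarrow> f j \<ge> f (j + 1))}"

definition Omega :: "nat \<Rightarrow> 'a::field \<Rightarrow> 'a \<Rightarrow> nat \<Rightarrow> 'a" where
  "Omega n p q m = (\<Sum>f\<in>relaxed_partitions n m. p ^ f 1 * q ^ (m + 1 - f 1))"

definition G :: "nat \<Rightarrow> 'a::field \<Rightarrow> 'a \<Rightarrow> 'a fps" where
  "G n p q =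
     (if n = 0 then fps_const (p * q) * fps_X / (1 - fps_const q * fps_X)
      else Abs_fps (\<lambda>m. if m \<ge> 1 then Omega n p q m else 0))"

definition Ret1 :: "nat \<Rightarrow> (nat \<Rightarrow> nat) \<Rightarrow> nat set" where
  "Ret1 n w = {i \<in> {1..n - 1}. inv w i > inv w (i + 1) + 1}"

definition updown_perms :: "nat \<Rightarrow> (nat \<Rightarrow> nat) set" where
  "updown_perms n =
     {u. u permutes {1..n} \<and>
        (\<forall>j\<in>{1..<n}. (odd j \<longrightarrow> u j < u (j + 1)) \<and> (even j \<longrightarrow> u j > u (j + 1)))}"

definition ret1_minus :: "nat \<Rightarrow> (nat \<Rightarrow> nat) \<Rightarrow> nat" where
  "ret1_minus n u = card (Ret1 n u \<inter> {1..u 1})"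

definition ret1_plus :: "nat \<Rightarrow> (nat \<Rightarrow> nat) \<Rightarrow> nat" where
  "ret1_plus n u = card (Ret1 n u \<inter> {u 1 + 1..n - 1})"

definition U :: "nat \<Rightarrow> 'a::field \<Rightarrow> 'a \<Rightarrow> 'a" where
  "U n s t =
     (if n = 0 then 1
      else \<Sum>u\<in>updown_perms n.
             s ^ ret1_minus n u * t ^ ret1_plus n u * ((1 - t) / (1 - s)) ^ u 1)"

end

theory Submission imports Defs begin

text \<open>
  Part (a): deleting the first entry of a relaxed partition of \<open>[n + 1]\<close> and complementing the
  rest by \<open>v \<mapsto> m + 1 - v\<close> gives a relaxed partition of \<open>[n]\<close>; summing over the deleted entry is a
  geometric sum.

  Part (b) is part (a) read through Stanley's theory of \<open>P\<close>-partitions. Sorting the values of a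
  relaxed partition, with ties broken by a natural labelling of the zig-zag poset, attaches to it
  an up-down permutation \<open>u\<close>, and the partitions attached to \<open>u\<close> are the weakly increasing chains
  of values that increase strictly at the big returns of \<open>u\<close>. The generating function of such
  chains is a product of geometric series in the gaps, whence
  \<open>G n p q (1 - q X) ^ (n + 1) = p q X U n (p X) (q X)\<close>.
\<close>

subsection \<open>The recurrence for \<open>G\<close>\<close>

text \<open>A homogeneous geometric sum that telescopes after multiplication by
  \<open>p - q\<close>, so no division occurs. The bound \<open>k \<le> m\<close> keeps the
  subtractions in the exponents exact.\<close>

lemma sum_mixed_powers:
  fixes p q :: "'a::comm_ring_1"
  assumes "k \<le> m"
  shows "(p - q) * (\<Sum>i=1..k. p ^ i * q ^ (m + 1 - i)) = p * (p ^ k * q ^ (m + 1 - k) - q ^ (m + 1))"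
  using assms
proof (induction k)
  case (Suc k)
  then have e: "m + 1 - k = Suc (m - k)" by simp
  have "(p - q) * (\<Sum>i=1..Suc k. p ^ i * q ^ (m + 1 - i)) =
        p * (p ^ k * q ^ (m + 1 - k) - q ^ (m + 1)) + (p - q) * (p ^ Suc k * q ^ (m - k))"
    using Suc by (simp add: distrib_left)
  also have "\<dots> = p * (p ^ Suc k * q ^ (m + 1 - Suc k) - q ^ (m + 1))"
    unfolding e by (simp add: algebra_simps)
  finally show ?case .
qed simp

lemma finite_relaxed_partitions: "finite (relaxed_partitions n m)"
  by (rule finite_subset[of _ "{1..n} \<rightarrow>\<^sub>E {1..m}"]) (auto simp: relaxed_partitions_def intro!: finite_PiE)

lemma relaxed_partitions_one:
  "bij_betw (\<lambda>i j. if j = 1 then i else undefined) {1..m} (relaxed_partitions 1 m)"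
  by (rule bij_betw_byWitness[of _ "\<lambda>f. f 1"])
     (auto simp: relaxed_partitions_def PiE_def extensional_def Pi_def fun_eq_iff)

text \<open>Shifting indices by one swaps odd and even, and complementation reverses inequalities,
  so the two effects cancel. The one remaining condition, between the first two entries, becomes the
  range \<open>{1..m + 1 - g 1}\<close> of the deleted entry.\<close>

lemma relaxed_partitions_Suc:
  assumes "n \<ge> 1"
  shows "bij_betw (\<lambda>(g, i) j. if j = 1 then i else if j \<in> {2..n+1} then m + 1 - g (j - 1) else undefined)
           (SIGMA g:relaxed_partitions n m. {1..m + 1 - g 1}) (relaxed_partitions (n + 1) m)"
proof (rule bij_betw_byWitness[of _ "\<lambda>f. (\<lambda>j. if j \<in> {1..n} then m + 1 - f (j + 1) else undefined, f 1)"])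
  let ?S = "SIGMA g:relaxed_partitions n m. {1..m + 1 - g 1}"
  let ?F = "\<lambda>(g, i) j. if j = 1 then i else if j \<in> {2..n+1} then m + 1 - g (j - 1) else undefined"
  let ?B = "\<lambda>f. (\<lambda>j. if j \<in> {1..n} then m + 1 - f (j + 1) else undefined, f 1)"
  have rng: "g j \<ge> 1" "g j \<le> m" if "g \<in> relaxed_partitions k m" "1 \<le> j" "j \<le> k" for g j k
    using that by (auto simp: relaxed_partitions_def PiE_def Pi_def)
  have undef: "g j = undefined" if "g \<in> relaxed_partitions k m" "j \<notin> {1..k}" for g j k
    using that by (auto simp: relaxed_partitions_def PiE_def extensional_def)
  show "\<forall>a\<in>?S. ?B (?F a) = a"
  proof
    fix x assume "x \<in> ?S"
    then obtain g i where x: "x = (g, i)" and g: "g \<in> relaxed_partitions n m" by blast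
    have "m + 1 - (m + 1 - g j) = g j" if "1 \<le> j" "j \<le> n" for j
      using rng[OF g that] by simp
    then show "?B (?F x) = x" using undef[OF g] by (auto simp: x fun_eq_iff)
  qed
  show "\<forall>f\<in>relaxed_partitions (n + 1) m. ?F (?B f) = f"
  proof (intro ballI ext)
    fix f j assume f: "f \<in> relaxed_partitions (n + 1) m"
    show "?F (?B f) j = f j"
      using rng[OF f, of j] undef[OF f, of j] by auto
  qed
  show "?F ` ?S \<subseteq> relaxed_partitions (n + 1) m"
  proof (rule image_subsetI)
    fix x assume "x \<in> ?S"
    then obtain g i where x: "x = (g, i)"
      and g: "g \<in> relaxed_partitions n m" and i: "i \<in> {1..m + 1 - g 1}" by blast
    have alt: "(odd j \<longrightarrow> g j \<le> g (j + 1)) \<and> (even j \<longrightarrow> g j \<ge> g (j + 1))" if "1 \<le> j" "j < n" for j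
      using g that by (auto simp: relaxed_partitions_def)
    have "?F (g, i) \<in> {1..n+1} \<rightarrow>\<^sub>E {1..m}"
    proof (rule PiE_I)
      fix j assume "j \<in> {1..n+1}"
      then consider "j = 1" | "j \<in> {2..n+1}" "1 \<le> j - 1" "j - 1 \<le> n" by force
      then show "?F (g, i) j \<in> {1..m}"
      proof cases
        case 1
        then show ?thesis using i rng[OF g, of 1] assms by auto
      next
        case 2
        then show ?thesis using rng[OF g 2(2,3)] by auto
      qed
    qed auto
    moreover have "(odd j \<longrightarrow> ?F (g, i) j \<le> ?F (g, i) (j + 1)) \<and> (even j \<longrightarrow> ?F (g, i) j \<ge> ?F (g, i) (j + 1))"
      if j: "j \<in> {1..<n+1}" for j
    proof (cases "j = 1")
      case True
      then show ?thesis using i assms by auto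
    next
      case False
      with j have "j = (j - 1) + 1" "1 \<le> j - 1" "j - 1 < n" by auto
      then obtain l where "j = l + 1" "1 \<le> l" "l < n" by blast
      then show ?thesis using alt[of l] by (auto intro!: diff_le_mono2)
    qed
    ultimately show "?F x \<in> relaxed_partitions (n + 1) m"
      unfolding relaxed_partitions_def x by blast
  qed
  show "?B ` relaxed_partitions (n + 1) m \<subseteq> ?S"
  proof (rule image_subsetI)
    fix f assume f: "f \<in> relaxed_partitions (n + 1) m"
    have alt: "(odd j \<longrightarrow> f j \<le> f (j + 1)) \<and> (even j \<longrightarrow> f j \<ge> f (j + 1))" if "1 \<le> j" "j < n + 1" for j
      using f that by (auto simp: relaxed_partitions_def)
    have "fst (?B f) \<in> {1..n} \<rightarrow>\<^sub>E {1..m}"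
    proof (rule PiE_I)
      fix j assume "j \<in> {1..n}"
      then show "fst (?B f) j \<in> {1..m}"
        using rng[OF f, of "j + 1"] by auto
    qed auto
    moreover have "(odd j \<longrightarrow> fst (?B f) j \<le> fst (?B f) (j + 1)) \<and> (even j \<longrightarrow> fst (?B f) j \<ge> fst (?B f) (j + 1))"
      if j: "j \<in> {1..<n}" for j
      using alt[of "j + 1"] j by (auto intro!: diff_le_mono2)
    ultimately have "fst (?B f) \<in> relaxed_partitions n m"
      unfolding relaxed_partitions_def by blast
    moreover have "f 1 \<in> {1..m + 1 - fst (?B f) 1}"
      using assms alt[of 1] rng[OF f, of 1] rng[OF f, of 2] by (auto simp: numeral_2_eq_2)
    ultimately show "?B f \<in> ?S" by auto
  qed
qed

lemma Omega_one:
  fixes p q :: "'a::field"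
  shows "(p - q) * Omega 1 p q m = p * q * (p ^ m - q ^ m)"
proof -
  have "Omega 1 p q m = (\<Sum>i=1..m. p ^ i * q ^ (m + 1 - i))"
    unfolding Omega_def by (subst sum.reindex_bij_betw[OF relaxed_partitions_one, symmetric]) simp
  then show ?thesis
    using sum_mixed_powers[of m m p q] by (simp add: algebra_simps)
qed

text \<open>With \<open>k = m + 1 - g 1\<close>, the upper end of the geometric sum over the deleted
  entry is the weight of \<open>g\<close> with \<open>p\<close> and \<open>q\<close>
  exchanged.\<close>

lemma Omega_Suc:
  fixes p q :: "'a::field"
  assumes "n \<ge> 1"
  shows "(p - q) * Omega (n + 1) p q m = p * (Omega n q p m - Omega n q q m)"
proof -
  have "Omega (n + 1) p q m =
      (\<Sum>(g, i)\<in>(SIGMA g:relaxed_partitions n m. {1..m + 1 - g 1}). p ^ i * q ^ (m + 1 - i))"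
    unfolding Omega_def
    by (subst sum.reindex_bij_betw[OF relaxed_partitions_Suc[OF assms], symmetric])
       (simp add: case_prod_unfold)
  also have "\<dots> = (\<Sum>g\<in>relaxed_partitions n m. \<Sum>i=1..m + 1 - g 1. p ^ i * q ^ (m + 1 - i))"
    by (subst sum.Sigma) (auto simp: finite_relaxed_partitions)
  finally have "(p - q) * Omega (n + 1) p q m =
      (\<Sum>g\<in>relaxed_partitions n m. (p - q) * (\<Sum>i=1..m + 1 - g 1. p ^ i * q ^ (m + 1 - i)))"
    by (simp only: sum_distrib_left)
  also have "\<dots> = (\<Sum>g\<in>relaxed_partitions n m.
      p * (q ^ g 1 * p ^ (m + 1 - g 1) - q ^ g 1 * q ^ (m + 1 - g 1)))"
  proof (rule sum.cong)
    fix g assume "g \<in> relaxed_partitions n m"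
    then have g: "1 \<le> g 1" "g 1 \<le> m"
      using assms by (auto simp: relaxed_partitions_def PiE_def Pi_def)
    \<comment> \<open>The lower end of the geometric sum does not depend on \<open>g\<close>;
      splitting it this way exhibits it as the weight of \<open>g\<close> in
      \<open>Omega n q q m\<close>.\<close>
    have e: "q ^ g 1 * q ^ (m + 1 - g 1) = q ^ (m + 1)"
      using g by (simp flip: power_add)
    show "(p - q) * (\<Sum>i=1..m + 1 - g 1. p ^ i * q ^ (m + 1 - i)) =
        p * (q ^ g 1 * p ^ (m + 1 - g 1) - q ^ g 1 * q ^ (m + 1 - g 1))"
      using sum_mixed_powers[of "m + 1 - g 1" m p q] g unfolding e
      by (simp add: mult.commute)
  qed simp
  also have "\<dots> = p * (Omega n q p m - Omega n q q m)"
    by (simp add: Omega_def right_diff_distrib sum_subtractf sum_distrib_left)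
  finally show ?thesis .
qed

lemma one_minus_const_X_nonzero:
  fixes q :: "'a::field"
  shows "1 - fps_const q * fps_X \<noteq> 0"
proof
  assume "1 - fps_const q * fps_X = 0"
  then have "(1 - fps_const q * fps_X) $ 0 = 0" by (simp only: fps_zero_nth)
  then show False by simp
qed

text \<open>These coefficients play the part of \<open>Omega 0 p q m\<close>: with them
  \<open>Omega_one\<close> is the case \<open>n = 0\<close> of \<open>Omega_Suc\<close>.\<close>

lemma G_zero_nth:
  fixes p q :: "'a::field"
  shows "G 0 p q $ m = (if m = 0 then 0 else p * q ^ m)"
proof -
  have "G 0 p q * (1 - fps_const q * fps_X) = fps_const (p * q) * fps_X"
    by (simp add: G_def fps_divide_unit mult.assoc inverse_mult_eq_1)
  moreover have "Abs_fps (\<lambda>m. if m = 0 then 0 else p * q ^ m) * (1 - fps_const q * fps_X) = fps_const (p * q) * fps_X"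
  proof (rule fps_ext)
    fix k
    show "(Abs_fps (\<lambda>m. if m = 0 then 0 else p * q ^ m) * (1 - fps_const q * fps_X)) $ k =
      (fps_const (p * q) * fps_X) $ k"
      by (cases k; cases "k - 1") (auto simp: algebra_simps simp flip: fps_const_mult)
  qed
  moreover have "1 - fps_const q * fps_X \<noteq> 0"
    by (rule one_minus_const_X_nonzero)
  ultimately have "G 0 p q = Abs_fps (\<lambda>m. if m = 0 then 0 else p * q ^ m)"
    by (metis mult_right_cancel)
  then show ?thesis by simp
qed

lemma G_nth:
  assumes "n \<ge> 1"
  shows "G n p q $ m = (if m = 0 then 0 else Omega n p q m)"
  using assms by (simp add: G_def)

theorem G_Suc:
  fixes p q :: "'a::field"
  assumes "p \<noteq> q"
  shows "G (n + 1) p q = fps_const (p / (p - q)) * (G n q p - G n q q)"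
proof (rule fps_ext)
  fix m
  show "G (n + 1) p q $ m = (fps_const (p / (p - q)) * (G n q p - G n q q)) $ m"
  proof (cases "m = 0")
    case True
    then show ?thesis by (cases "n = 0") (simp_all add: G_nth G_zero_nth)
  next
    case False
    have "(p - q) * G (n + 1) p q $ m = p * (G n q p $ m - G n q q $ m)"
      using False Omega_one[of p q m] Omega_Suc[of n p q m]
      by (cases "n = 0") (simp_all add: G_nth G_zero_nth algebra_simps)
    then have "G (n + 1) p q $ m = p * (G n q p $ m - G n q q $ m) / (p - q)"
      using assms by (simp add: eq_divide_eq mult.commute)
    then show ?thesis by simp
  qed
qed

subsection \<open>Chains with prescribed strict steps\<close>

definition chain_step :: "nat set \<Rightarrow> nat \<Rightarrow> nat \<Rightarrow> nat \<Rightarrow> bool" where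
  "chain_step R j x y \<longleftrightarrow> (if j \<in> R then x < y else x \<le> y)"

lemma chain_step_le: "chain_step R j x y \<Longrightarrow> x \<le> y"
  by (auto simp: chain_step_def split: if_splits)

text \<open>The bound \<open>m\<close> acts as an entry at position \<open>n + 1\<close>, so the gap
  above the last entry is subject to \<open>R\<close> like any other.\<close>

definition gap_chains :: "nat set \<Rightarrow> nat \<Rightarrow> nat \<Rightarrow> (nat \<Rightarrow> nat) set" where
  "gap_chains R n m = {a \<in> {1..n} \<rightarrow>\<^sub>E {1..m}. \<forall>j\<in>{1..n}. chain_step R j (a j) (if j = n then m else a (j + 1))}"

lemma finite_gap_chains: "finite (gap_chains R n m)"
  by (rule finite_subset[of _ "{1..n} \<rightarrow>\<^sub>E {1..m}"]) (auto simp: gap_chains_def intro!: finite_PiE)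

lemma gap_chains_0: "gap_chains R 0 m = {\<lambda>_. undefined}"
  by (auto simp: gap_chains_def)

text \<open>The last entry \<open>b\<close> becomes the bound of the shorter chain; this recursion
  turns generating functions into products.\<close>

lemma gap_chains_Suc:
  "bij_betw (\<lambda>(b, a). a(Suc n := b)) (SIGMA b:{b\<in>{1..m}. chain_step R (Suc n) b m}. gap_chains R n b)
     (gap_chains R (Suc n) m)"
proof (rule bij_betw_byWitness[of _ "\<lambda>c. (c (Suc n), c(Suc n := undefined))"])
  let ?S = "SIGMA b:{b\<in>{1..m}. chain_step R (Suc n) b m}. gap_chains R n b"
  show "\<forall>x\<in>?S. (\<lambda>c. (c (Suc n), c(Suc n := undefined))) ((\<lambda>(b, a). a(Suc n := b)) x) = x"
    by (auto simp: gap_chains_def PiE_def extensional_def fun_eq_iff)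
  show "\<forall>c\<in>gap_chains R (Suc n) m. (\<lambda>(b, a). a(Suc n := b)) (c (Suc n), c(Suc n := undefined)) = c"
    by auto
  show "(\<lambda>(b, a). a(Suc n := b)) ` ?S \<subseteq> gap_chains R (Suc n) m"
  proof clarify
    fix b a assume b: "b \<in> {1..m}" "chain_step R (Suc n) b m" and a: "a \<in> gap_chains R n b"
    have "a(Suc n := b) \<in> {1..Suc n} \<rightarrow>\<^sub>E {1..m}"
      using a b by (fastforce simp: gap_chains_def PiE_def Pi_def extensional_def)
    moreover have "chain_step R j ((a(Suc n := b)) j) (if j = Suc n then m else (a(Suc n := b)) (j + 1))"
      if "j \<in> {1..Suc n}" for j
      using a b that by (auto simp: gap_chains_def split: if_splits)
    ultimately show "a(Suc n := b) \<in> gap_chains R (Suc n) m"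
      by (auto simp: gap_chains_def)
  qed
  show "(\<lambda>c. (c (Suc n), c(Suc n := undefined))) ` gap_chains R (Suc n) m \<subseteq> ?S"
  proof (rule image_subsetI)
    fix c assume c: "c \<in> gap_chains R (Suc n) m"
    have all: "\<forall>j\<in>{1..Suc n}. chain_step R j (c j) (if j = Suc n then m else c (j + 1))"
      using c unfolding gap_chains_def by blast
    have succ: "chain_step R j (c j) (c (j + 1))" if "1 \<le> j" "j \<le> n" for j
      using bspec[OF all, of j] that by simp
    \<comment> \<open>Weak steps propagate upwards, so the last entry can replace \<open>m\<close>
      as the bound on all others.\<close>
    have mono: "c j \<le> c (Suc n)" if "1 \<le> j" "j \<le> Suc n" for j
      using that(2)
    proof (induction rule: inc_induct)
      case (step k)
      then show ?case using \<open>1 \<le> j\<close> chain_step_le[OF succ, of k] by auto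
    qed simp
    have rng: "c j \<in> {1..m}" if "1 \<le> j" "j \<le> Suc n" for j
      using c that by (auto simp: gap_chains_def)
    have ext: "c j = undefined" if "j \<notin> {1..Suc n}" for j
      using c that by (auto simp: gap_chains_def PiE_def extensional_def)
    have "c(Suc n := undefined) \<in> {1..n} \<rightarrow>\<^sub>E {1..c (Suc n)}"
    proof (rule PiE_I)
      fix j assume "j \<in> {1..n}"
      then show "(c(Suc n := undefined)) j \<in> {1..c (Suc n)}"
        using mono[of j] rng[of j] by auto
    qed (use ext in auto)
    then have "c(Suc n := undefined) \<in> gap_chains R n (c (Suc n))"
      using succ by (auto simp: gap_chains_def)
    moreover have "chain_step R (Suc n) (c (Suc n)) m"
      using bspec[OF all, of "Suc n"] by simp
    ultimately show "(c (Suc n), c(Suc n := undefined)) \<in> ?S"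
      using rng[of "Suc n"] by auto
  qed
qed

text \<open>For \<open>n < k\<close> the entry \<open>a k\<close> is read as the bound \<open>m\<close>, which makes the weight
  multiplicative in the gaps of the chain.\<close>

definition chain_weight :: "'a::field \<Rightarrow> 'a \<Rightarrow> nat \<Rightarrow> nat \<Rightarrow> (nat \<Rightarrow> nat) \<Rightarrow> nat \<Rightarrow> 'a" where
  "chain_weight p q k n a m = (if n < k then p ^ (m - 1) else p ^ (a k - 1) * q ^ (m - a k))"

definition chain_gf :: "'a::field \<Rightarrow> 'a \<Rightarrow> nat \<Rightarrow> nat set \<Rightarrow> nat \<Rightarrow> 'a fps" where
  "chain_gf p q k R n =
     Abs_fps (\<lambda>m. if m = 0 then 0 else \<Sum>a\<in>gap_chains R n m. chain_weight p q k n a m)"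

definition gap_gf :: "'a::field \<Rightarrow> bool \<Rightarrow> 'a fps" where
  "gap_gf y b = Abs_fps (\<lambda>d. if b \<and> d = 0 then 0 else y ^ d)"

lemma gap_gf_eq:
  fixes y :: "'a::field"
  shows "gap_gf y b * (1 - fps_const y * fps_X) = (if b then fps_const y * fps_X else 1)"
proof (rule fps_ext)
  fix k
  show "(gap_gf y b * (1 - fps_const y * fps_X)) $ k = (if b then fps_const y * fps_X else 1) $ k"
    by (cases k; cases "k - 1")
       (auto simp: gap_gf_def right_diff_distrib mult.assoc[symmetric] fps_mult_fps_X_commute)
qed

text \<open>The empty chain has a single gap, of size \<open>m - 1\<close>; the factor
  \<open>fps_X\<close> makes up for the shift by one.\<close>

lemma chain_gf_0:
  fixes p q :: "'a::field"
  assumes "k \<ge> 1"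
  shows "chain_gf p q k R 0 * (1 - fps_const p * fps_X) = fps_X"
proof -
  have "chain_gf p q k R 0 = fps_X * gap_gf p False"
    using assms by (auto simp: chain_gf_def gap_chains_0 chain_weight_def gap_gf_def fps_eq_iff)
  then show ?thesis
    by (simp add: mult.assoc gap_gf_eq)
qed

text \<open>Summing over the last entry is a convolution: the new gap is independent of the shorter
  chain and is weighted by \<open>p\<close> below position \<open>k\<close> and by \<open>q\<close>
  from there on.\<close>

lemma chain_gf_Suc:
  fixes p q :: "'a::field"
  assumes "k \<ge> 1"
  shows "chain_gf p q k R (Suc n) =
    chain_gf p q k R n * gap_gf (if Suc n < k then p else q) (Suc n \<in> R)"
proof (rule fps_ext)
  fix m
  let ?y = "if Suc n < k then p else q"
  let ?B = "{b\<in>{1..m}. chain_step R (Suc n) b m}"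
  show "chain_gf p q k R (Suc n) $ m =
    (chain_gf p q k R n * gap_gf ?y (Suc n \<in> R)) $ m"
  proof (cases "m = 0")
    case True
    then show ?thesis by (simp add: chain_gf_def)
  next
    case False
    \<comment> \<open>Up to \<open>Suc n = k\<close> the old weight is a power of \<open>p\<close>
      alone; for \<open>Suc n = k\<close> the marked entry is \<open>b\<close> itself, and the new
      gap is the first to carry \<open>q\<close>.\<close>
    have w: "chain_weight p q k (Suc n) (a(Suc n := b)) m = chain_weight p q k n a b * ?y ^ (m - b)"
      if b: "b \<in> {1..m}" and a: "a \<in> gap_chains R n b" for a b
    proof (cases "k \<le> n")
      case True
      then have "a k \<le> b" using a assms by (auto simp: gap_chains_def)
      then have "m - a k = (b - a k) + (m - b)" using b by auto
      then show ?thesis using True by (simp add: chain_weight_def power_add)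
    next
      case False
      have "m - 1 = (b - 1) + (m - b)" using b by auto
      then show ?thesis using False by (auto simp: chain_weight_def power_add)
    qed
    have "chain_gf p q k R (Suc n) $ m = (\<Sum>a\<in>gap_chains R (Suc n) m. chain_weight p q k (Suc n) a m)"
      using False by (simp add: chain_gf_def)
    also have "\<dots> = (\<Sum>(b, a)\<in>(SIGMA b:?B. gap_chains R n b). chain_weight p q k (Suc n) (a(Suc n := b)) m)"
      by (subst sum.reindex_bij_betw[OF gap_chains_Suc, symmetric]) (simp add: case_prod_unfold)
    also have "\<dots> = (\<Sum>b\<in>?B. \<Sum>a\<in>gap_chains R n b. chain_weight p q k (Suc n) (a(Suc n := b)) m)"
      by (subst sum.Sigma) (auto simp: finite_gap_chains)
    also have "\<dots> = (\<Sum>b\<in>?B. chain_gf p q k R n $ b * ?y ^ (m - b))"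
      by (rule sum.cong) (auto simp: w chain_gf_def sum_distrib_right intro!: sum.cong)
    \<comment> \<open>The added terms vanish: \<open>chain_gf\<close> has no constant term, and a
      strict gap excludes \<open>b = m\<close>.\<close>
    also have "\<dots> = (\<Sum>b\<in>{0..m}. chain_gf p q k R n $ b * gap_gf ?y (Suc n \<in> R) $ (m - b))"
      by (rule sum.mono_neutral_cong_left)
         (auto simp: gap_gf_def chain_step_def chain_gf_def split: if_splits)
    finally show ?thesis by (simp add: fps_mult_nth)
  qed
qed

text \<open>Each of the \<open>n + 1\<close> gaps gives a factor \<open>1 / (1 - y i)\<close>, with
  an extra \<open>y i\<close> when strict. Index 0 is the gap from 1 up to the first entry, which is
  never strict.\<close>

lemma chain_gf_prod:
  fixes p q :: "'a::field" and k :: nat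
  assumes "k \<ge> 1"
  defines "y \<equiv> \<lambda>i. fps_const (if i < k then p else q) * fps_X"
  shows "chain_gf p q k R n * (\<Prod>i=0..n. 1 - y i) = fps_X * (\<Prod>i\<in>R \<inter> {1..n}. y i)"
proof (induction n)
  case 0
  then show ?case using chain_gf_0[of k p q R] assms by simp
next
  case (Suc n)
  let ?g = "gap_gf (if Suc n < k then p else q) (Suc n \<in> R)"
  have g: "?g * (1 - y (Suc n)) = (if Suc n \<in> R then y (Suc n) else 1)"
    unfolding y_def by (rule gap_gf_eq)
  have R: "R \<inter> {1..Suc n} = (if Suc n \<in> R then insert (Suc n) (R \<inter> {1..n}) else R \<inter> {1..n})"
    by (auto simp: le_Suc_eq)
  have "chain_gf p q k R (Suc n) * (\<Prod>i=0..Suc n. 1 - y i) =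
      (chain_gf p q k R n * (\<Prod>i=0..n. 1 - y i)) * (?g * (1 - y (Suc n)))"
    by (simp add: chain_gf_Suc[OF assms(1)] prod.atLeast0_atMost_Suc mult_ac)
  also have "\<dots> = fps_X * (\<Prod>i\<in>R \<inter> {1..Suc n}. y i)"
    unfolding Suc g R by (simp add: mult_ac)
  finally show ?case .
qed

lemma chain_gf_closed_form:
  fixes p q :: "'a::field"
  assumes "1 \<le> k" "k \<le> n"
  shows "chain_gf p q k R n * ((1 - fps_const p * fps_X) ^ k * (1 - fps_const q * fps_X) ^ (n + 1 - k)) =
    fps_X * ((fps_const p * fps_X) ^ card (R \<inter> {1..<k}) * (fps_const q * fps_X) ^ card (R \<inter> {k..n}))"
proof -
  let ?y = "\<lambda>i. fps_const (if i < k then p else q) * fps_X"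
  have "(\<Prod>i=0..n. 1 - ?y i) = (\<Prod>i\<in>{0..<k} \<union> {k..n}. 1 - ?y i)"
    using assms by (intro prod.cong) auto
  also have "\<dots> = (\<Prod>i\<in>{0..<k}. 1 - ?y i) * (\<Prod>i\<in>{k..n}. 1 - ?y i)"
    by (rule prod.union_disjoint) auto
  also have "\<dots> = (1 - fps_const p * fps_X) ^ k * (1 - fps_const q * fps_X) ^ (n + 1 - k)"
    by simp
  finally have 1: "(\<Prod>i=0..n. 1 - ?y i) = \<dots>" .
  have "(\<Prod>i\<in>R \<inter> {1..n}. ?y i) = (\<Prod>i\<in>(R \<inter> {1..<k}) \<union> (R \<inter> {k..n}). ?y i)"
    using assms by (intro prod.cong) auto
  also have "\<dots> = (\<Prod>i\<in>R \<inter> {1..<k}. ?y i) * (\<Prod>i\<in>R \<inter> {k..n}. ?y i)"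
    by (rule prod.union_disjoint) auto
  also have "\<dots> = (\<Prod>i\<in>R \<inter> {1..<k}. fps_const p * fps_X) * (\<Prod>i\<in>R \<inter> {k..n}. fps_const q * fps_X)"
    by (intro arg_cong2[of _ _ _ _ "(*)"] prod.cong) auto
  also have "\<dots> = (fps_const p * fps_X) ^ card (R \<inter> {1..<k}) * (fps_const q * fps_X) ^ card (R \<inter> {k..n})"
    by simp
  finally have 2: "(\<Prod>i\<in>R \<inter> {1..n}. ?y i) = \<dots>" .
  show ?thesis using chain_gf_prod[OF assms(1), of p q R n] unfolding 1 2 .
qed

subsection \<open>Sorting relaxed partitions\<close>

text \<open>The labels follow the usual order except that each even \<open>j\<close> is exchanged
  with \<open>j + 1\<close>, which lies below it in the zig-zag poset.\<close>

definition natural_label :: "nat \<Rightarrow> nat" where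
  "natural_label j = (if odd j then j - 1 else j + 1)"

text \<open>The lexicographic order on pairs of value and label, encoded in one number: labels of
  indices up to \<open>n\<close> are smaller than \<open>n + 2\<close>.\<close>

definition rank_key :: "nat \<Rightarrow> (nat \<Rightarrow> nat) \<Rightarrow> nat \<Rightarrow> nat" where
  "rank_key n f j = f j * (n + 2) + natural_label j"

lemma rank_key_less_iff:
  assumes "a \<le> n" "b \<le> n"
  shows "rank_key n f a < rank_key n f b \<longleftrightarrow>
    f a < f b \<or> f a = f b \<and> natural_label a < natural_label b"
proof -
  have bnd: "natural_label a < n + 2" "natural_label b < n + 2"
    using assms by (auto simp: natural_label_def)
  have less: "x * (n + 2) + c < y * (n + 2) + d" if "x < y" "c < n + 2" for x y c d :: nat
  proof -
    have "(x + 1) * (n + 2) \<le> y * (n + 2)" using that by (intro mult_right_mono) auto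
    then show ?thesis using that(2) by (simp add: algebra_simps)
  qed
  show ?thesis
    using less[of "f a" "f b"] less[of "f b" "f a"] bnd
    unfolding rank_key_def by (metis add_less_cancel_left linorder_neqE_nat not_less_iff_gr_or_eq)
qed

lemma natural_label_inj: "natural_label a = natural_label b \<Longrightarrow> a = b"
  unfolding natural_label_def by (simp split: if_splits) presburger+

lemma rank_key_inj:
  assumes "rank_key n f a = rank_key n f b" "a \<le> n" "b \<le> n"
  shows "a = b"
  using rank_key_less_iff[of a n b f] rank_key_less_iff[of b n a f] assms natural_label_inj[of a b]
  by (metis linorder_neqE_nat less_irrefl)

lemma natural_label_Suc:
  "odd j \<Longrightarrow> natural_label j < natural_label (j + 1)"
  "even j \<Longrightarrow> natural_label (j + 1) < natural_label j"
  by (auto simp: natural_label_def)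

text \<open>Only neighbouring indices can be out of order, since the labelling moves no index past
  more than one other.\<close>

lemma natural_label_far: "b + 1 < a \<Longrightarrow> natural_label b < natural_label a"
  unfolding natural_label_def by (auto split: if_splits) presburger+

lemma updown_permsD:
  assumes "u \<in> updown_perms n"
  shows "u permutes {1..n}"
    and "1 \<le> j \<Longrightarrow> j < n \<Longrightarrow> odd j \<Longrightarrow> u j < u (j + 1)"
    and "1 \<le> j \<Longrightarrow> j < n \<Longrightarrow> even j \<Longrightarrow> u (j + 1) < u j"
  using assms by (auto simp: updown_perms_def)

text \<open>Neighbours \<open>j\<close>, \<open>j + 1\<close> are comparable in the zig-zag poset, so a return that is not big
  is forced by the poset; this is why big returns are the descents of \<^const>\<open>natural_label\<close>.\<close>

lemma Ret1_iff_natural_label: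
  assumes u: "u \<in> updown_perms n" and i: "i \<in> {1..<n}"
  shows "i \<in> Ret1 n u \<longleftrightarrow> natural_label (inv u (i + 1)) < natural_label (inv u i)"
proof -
  define a b where "a = inv u i" and "b = inv u (i + 1)"
  have perm: "u permutes {1..n}" using updown_permsD[OF u] by simp
  have ua: "u a = i" and ub: "u b = i + 1"
    using permutes_inverses(1)[OF perm] by (auto simp: a_def b_def)
  have ab: "a \<in> {1..n}" "b \<in> {1..n}"
    using permutes_in_image[OF permutes_inv[OF perm]] i by (auto simp: a_def b_def)
  have ne: "a \<noteq> b" using ua ub by auto
  have "i \<in> Ret1 n u \<longleftrightarrow> b + 1 < a"
    using i by (auto simp: Ret1_def a_def b_def)
  moreover consider "b + 1 < a" | "a = b + 1" | "b = a + 1" | "a + 1 < b"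
    using ne by linarith
  then have "b + 1 < a \<longleftrightarrow> natural_label b < natural_label a"
  proof cases
    case 1
    then show ?thesis using natural_label_far by simp
  next
    case 2
    \<comment> \<open>Here \<open>u\<close> descends from \<open>b\<close> to \<open>b + 1\<close>,
      which alternation permits only at even positions.\<close>
    then have "even b" using updown_permsD(2)[OF u, of b] ab ua ub by fastforce
    then show ?thesis using 2 natural_label_Suc(2)[of b] by simp
  next
    case 3
    then have "odd a" using updown_permsD(3)[OF u, of a] ab ua ub by fastforce
    then show ?thesis using 3 natural_label_Suc(1)[of a] by simp
  next
    case 4
    then show ?thesis using natural_label_far[of a b] by simp
  qed
  ultimately show ?thesis by (simp add: a_def b_def)
qed

text \<open>In other words, \<open>u\<close> is the standardisation of \<open>f\<close> with ties
  broken by \<open>natural_label\<close>.\<close>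

definition sorted_by :: "nat \<Rightarrow> (nat \<Rightarrow> nat) \<Rightarrow> (nat \<Rightarrow> nat) \<Rightarrow> bool" where
  "sorted_by n u f \<longleftrightarrow> (\<forall>j\<in>{1..n}. \<forall>k\<in>{1..n}. u j < u k \<longleftrightarrow> rank_key n f j < rank_key n f k)"

text \<open>It suffices to compare keys at consecutive ranks. Equal values are allowed there exactly
  when the labels increase, that is, when the rank is not a big return.\<close>

lemma sorted_by_iff_chain_step:
  assumes u: "u \<in> updown_perms n"
  shows "sorted_by n u f \<longleftrightarrow> (\<forall>i\<in>{1..<n}. chain_step (Ret1 n u) i (f (inv u i)) (f (inv u (i + 1))))"
proof -
  have perm: "u permutes {1..n}" using updown_permsD[OF u] by simp
  have uinv: "u (inv u i) = i" "inv u (u i) = i" for i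
    using permutes_inverses[OF perm] by auto
  have inv_in: "inv u i \<in> {1..n}" if "i \<in> {1..n}" for i
    using permutes_in_image[OF permutes_inv[OF perm]] that by blast
  have u_in: "u i \<in> {1..n}" if "i \<in> {1..n}" for i
    using permutes_in_image[OF perm] that by blast
  let ?K = "\<lambda>i. rank_key n f (inv u i)"
  have step: "chain_step (Ret1 n u) i (f (inv u i)) (f (inv u (i + 1))) \<longleftrightarrow> ?K i < ?K (i + 1)"
    if i: "i \<in> {1..<n}" for i
  proof -
    have le: "inv u i \<le> n" "inv u (i + 1) \<le> n"
      using inv_in[of i] inv_in[of "i + 1"] i by auto
    have "inv u i \<noteq> inv u (i + 1)" using uinv by (metis Suc_eq_plus1 n_not_Suc_n)
    then have ne: "natural_label (inv u i) \<noteq> natural_label (inv u (i + 1))"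
      using natural_label_inj by blast
    show ?thesis
      unfolding rank_key_less_iff[OF le] chain_step_def Ret1_iff_natural_label[OF u i]
      using ne by auto
  qed
  have "sorted_by n u f \<longleftrightarrow> (\<forall>i\<in>{1..<n}. ?K i < ?K (i + 1))"
  proof
    assume *: "sorted_by n u f"
    show "\<forall>i\<in>{1..<n}. ?K i < ?K (i + 1)"
    proof
      fix i assume "i \<in> {1..<n}"
      then have "inv u i \<in> {1..n}" "inv u (i + 1) \<in> {1..n}"
        using inv_in[of i] inv_in[of "i + 1"] by simp_all
      then show "?K i < ?K (i + 1)"
        using * uinv unfolding sorted_by_def by (metis less_add_one)
    qed
  next
    assume *: "\<forall>i\<in>{1..<n}. ?K i < ?K (i + 1)"
    have mono: "?K i < ?K j" if "1 \<le> i" "i < j" "j \<le> n" for i j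
      using that(2,3)
    proof (induction j)
      case (Suc j)
      then show ?case using * that(1) by (cases "i = j") (auto intro: less_trans)
    qed simp
    show "sorted_by n u f"
      unfolding sorted_by_def
    proof (intro ballI)
      fix j k assume jk: "j \<in> {1..n}" "k \<in> {1..n}"
      then have "u j \<in> {1..n}" "u k \<in> {1..n}" using u_in by blast+
      then show "u j < u k \<longleftrightarrow> rank_key n f j < rank_key n f k"
        using mono[of "u j" "u k"] mono[of "u k" "u j"] uinv
        by (metis atLeastAtMost_iff linorder_neqE_nat order_less_asym order_less_irrefl)
    qed
  qed
  then show ?thesis using step by simp
qed

section \<open>Uniqueness and existence of the sorting permutation\<close>

text \<open>The indices with key at most that of \<open>j\<close> are mapped by \<open>u\<close>
  onto \<open>{1..u j}\<close>. Hence \<open>f\<close> determines \<open>u\<close>.\<close>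

lemma sorted_by_rank:
  assumes perm: "u permutes {1..n}" and srt: "sorted_by n u f" and j: "j \<in> {1..n}"
  shows "u j = card {k\<in>{1..n}. rank_key n f k \<le> rank_key n f j}"
proof -
  have "{k\<in>{1..n}. rank_key n f k \<le> rank_key n f j} = {k\<in>{1..n}. u k \<le> u j}"
    using srt j unfolding sorted_by_def by (auto simp flip: not_less)
  moreover have "u ` {k\<in>{1..n}. u k \<le> u j} = {1..u j}"
  proof -
    have "u ` {k\<in>{1..n}. u k \<le> u j} = {i \<in> u ` {1..n}. i \<le> u j}" by auto
    also have "\<dots> = {1..u j}"
      using permutes_image[OF perm] permutes_in_image[OF perm, of j] j by auto
    finally show ?thesis .
  qed
  moreover have "inj_on u {k\<in>{1..n}. u k \<le> u j}"
    using permutes_inj[OF perm] by (rule inj_on_subset) simp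
  ultimately show ?thesis by (metis card_atLeastAtMost card_image diff_Suc_1)
qed

lemma sorted_by_unique:
  assumes "u permutes {1..n}" "v permutes {1..n}" "sorted_by n u f" "sorted_by n v f"
  shows "u = v"
proof
  fix j
  show "u j = v j"
    using sorted_by_rank[OF assms(1,3), of j] sorted_by_rank[OF assms(2,4), of j]
      permutes_not_in[OF assms(1), of j] permutes_not_in[OF assms(2), of j]
    by (cases "j \<in> {1..n}") auto
qed

lemma ex_sorted_by: "\<exists>u. u permutes {1..n} \<and> sorted_by n u f"
proof -
  let ?S = "\<lambda>j. {k\<in>{1..n}. rank_key n f k \<le> rank_key n f j}"
  \<comment> \<open>The rank formula of \<open>sorted_by_rank\<close> taken as a definition; fixing
    all other points is what \<open>permutes\<close> demands.\<close>
  define u where "u j = (if j \<in> {1..n} then card (?S j) else j)" for j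
  have less: "u j < u k" if "j \<in> {1..n}" "k \<in> {1..n}" "rank_key n f j < rank_key n f k" for j k
  proof -
    have "?S j \<subseteq> ?S k" using that by auto
    moreover have "k \<in> ?S k" "k \<notin> ?S j" using that by auto
    ultimately have "?S j \<subset> ?S k" by blast
    then have "card (?S j) < card (?S k)" by (rule psubset_card_mono[rotated]) simp
    then show ?thesis using that by (simp add: u_def)
  qed
  have srt: "sorted_by n u f"
    unfolding sorted_by_def
  proof (intro ballI)
    fix j k assume jk: "j \<in> {1..n}" "k \<in> {1..n}"
    show "u j < u k \<longleftrightarrow> rank_key n f j < rank_key n f k"
      using less[OF jk] less[OF jk(2,1)] rank_key_inj[of n f j k] jk
      by (metis atLeastAtMost_iff linorder_neqE_nat order_less_asym order_less_irrefl)
  qed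
  have "inj_on u {1..n}"
    using less rank_key_inj[of n f] by (intro inj_onI) (metis atLeastAtMost_iff linorder_neqE_nat order_less_irrefl)
  moreover have "u ` {1..n} \<subseteq> {1..n}"
  proof clarify
    fix j assume j: "j \<in> {1..n}"
    have "card (?S j) \<le> card {1..n}" by (rule card_mono) auto
    moreover have "card (?S j) > 0" using j by (subst card_gt_0_iff) auto
    ultimately show "u j \<in> {1..n}" using j by (simp add: u_def)
  qed
  ultimately have "bij_betw u {1..n} {1..n}"
    by (simp add: bij_betw_def endo_inj_surj)
  then have "u permutes {1..n}"
    by (rule bij_imp_permutes) (simp only: u_def if_False)
  then show ?thesis using srt by blast
qed

section \<open>Decomposition of relaxed partitions by sorting permutation\<close>

text \<open>The fundamental lemma of \<open>P\<close>-partitions for the zig-zag poset. Labels agree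
  with the poset, so ties along its relations are broken in the direction that makes the sorting
  permutation alternate.\<close>

lemma relaxed_partitions_eq_UN:
  "relaxed_partitions n m = (\<Union>u\<in>updown_perms n. {f \<in> {1..n} \<rightarrow>\<^sub>E {1..m}. sorted_by n u f})"
proof (intro equalityI subsetI)
  fix f assume f: "f \<in> relaxed_partitions n m"
  obtain u where u: "u permutes {1..n}" "sorted_by n u f"
    using ex_sorted_by by blast
  have "(odd j \<longrightarrow> u j < u (j + 1)) \<and> (even j \<longrightarrow> u j > u (j + 1))" if j: "j \<in> {1..<n}" for j
  proof -
    have le: "j \<le> n" "j + 1 \<le> n" and mem: "j \<in> {1..n}" "j + 1 \<in> {1..n}" using j by auto
    have "(odd j \<longrightarrow> f j \<le> f (j + 1)) \<and> (even j \<longrightarrow> f j \<ge> f (j + 1))"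
      using f j by (auto simp: relaxed_partitions_def)
    then have "(odd j \<longrightarrow> rank_key n f j < rank_key n f (j + 1)) \<and>
        (even j \<longrightarrow> rank_key n f (j + 1) < rank_key n f j)"
      unfolding rank_key_less_iff[OF le] rank_key_less_iff[OF le(2,1)]
      using natural_label_Suc[of j] by auto
    then show ?thesis using u(2) mem unfolding sorted_by_def by simp
  qed
  then have "u \<in> updown_perms n" using u by (simp add: updown_perms_def)
  then show "f \<in> (\<Union>u\<in>updown_perms n. {f \<in> {1..n} \<rightarrow>\<^sub>E {1..m}. sorted_by n u f})"
    using f u by (auto simp: relaxed_partitions_def)
next
  fix f assume "f \<in> (\<Union>u\<in>updown_perms n. {f \<in> {1..n} \<rightarrow>\<^sub>E {1..m}. sorted_by n u f})"
  then obtain u where u: "u \<in> updown_perms n" "sorted_by n u f" and f: "f \<in> {1..n} \<rightarrow>\<^sub>E {1..m}" by blast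
  have "(odd j \<longrightarrow> f j \<le> f (j + 1)) \<and> (even j \<longrightarrow> f j \<ge> f (j + 1))" if j: "j \<in> {1..<n}" for j
  proof -
    have le: "j \<le> n" "j + 1 \<le> n" and mem: "j \<in> {1..n}" "j + 1 \<in> {1..n}" using j by auto
    have "(odd j \<longrightarrow> rank_key n f j < rank_key n f (j + 1)) \<and>
        (even j \<longrightarrow> rank_key n f (j + 1) < rank_key n f j)"
      using u(2) updown_permsD(2,3)[OF u(1), of j] j mem unfolding sorted_by_def by simp
    then show ?thesis
      unfolding rank_key_less_iff[OF le] rank_key_less_iff[OF le(2,1)] by auto
  qed
  then show "f \<in> relaxed_partitions n m" using f by (simp add: relaxed_partitions_def)
qed

text \<open>Composing with \<open>inv u\<close> lists the values of \<open>f\<close> in sorted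
  order, which gives the chain.\<close>

lemma bij_betw_gap_chains_sorted_by:
  assumes u: "u \<in> updown_perms n" and n: "n \<ge> 1"
  shows "bij_betw (\<lambda>a. a \<circ> u) (gap_chains (Ret1 n u) n m) {f \<in> {1..n} \<rightarrow>\<^sub>E {1..m}. sorted_by n u f}"
proof -
  have perm: "u permutes {1..n}" using updown_permsD[OF u] by simp
  have uinv: "u (inv u i) = i" "inv u (u i) = i" for i
    using permutes_inverses[OF perm] by auto
  \<comment> \<open>Hence the last step of the chain, up to the bound \<open>m\<close>, is weak and
    already implied by the range of the entries.\<close>
  have nR: "n \<notin> Ret1 n u" using n by (auto simp: Ret1_def)
  have chains_alt: "a \<in> gap_chains (Ret1 n u) n m \<longleftrightarrow> a \<in> {1..n} \<rightarrow>\<^sub>E {1..m} \<and>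
      (\<forall>i\<in>{1..<n}. chain_step (Ret1 n u) i (a i) (a (i + 1)))" for a
  proof -
    have "chain_step (Ret1 n u) n (a n) m" if "a \<in> {1..n} \<rightarrow>\<^sub>E {1..m}"
      using that n nR by (auto simp: chain_step_def)
    moreover have "{1..n} = insert n {1..<n}" using n by auto
    ultimately show ?thesis unfolding gap_chains_def by auto
  qed
  have comp: "a \<circ> v \<in> {1..n} \<rightarrow>\<^sub>E {1..m}"
    if "a \<in> {1..n} \<rightarrow>\<^sub>E {1..m}" "v permutes {1..n}" for a v
  proof (rule PiE_I)
    fix j assume "j \<in> {1..n}"
    then show "(a \<circ> v) j \<in> {1..m}" using that permutes_in_image[OF that(2), of j] by auto
  next
    fix j assume "j \<notin> {1..n}"
    then show "(a \<circ> v) j = undefined"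
      using that permutes_not_in[OF that(2)] by (auto simp: PiE_def extensional_def)
  qed
  show ?thesis
  proof (rule bij_betw_byWitness[of _ "\<lambda>f. f \<circ> inv u"])
    show "(\<lambda>a. a \<circ> u) ` gap_chains (Ret1 n u) n m \<subseteq> {f \<in> {1..n} \<rightarrow>\<^sub>E {1..m}. sorted_by n u f}"
      using comp[OF _ perm] by (simp add: image_subset_iff chains_alt sorted_by_iff_chain_step[OF u] uinv)
    show "(\<lambda>f. f \<circ> inv u) ` {f \<in> {1..n} \<rightarrow>\<^sub>E {1..m}. sorted_by n u f} \<subseteq> gap_chains (Ret1 n u) n m"
      using comp[OF _ permutes_inv[OF perm]] by (simp add: image_subset_iff chains_alt sorted_by_iff_chain_step[OF u])
  qed (auto simp: fun_eq_iff uinv)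
qed

lemma finite_updown_perms: "finite (updown_perms n)"
  by (rule finite_subset[of _ "{u. u permutes {1..n}}"]) (auto simp: updown_perms_def finite_permutations)

text \<open>The weight depends only on \<open>f 1\<close>, which is entry number \<open>u 1\<close>
  of the sorted chain, so that position is the marked one.\<close>

lemma G_eq_sum_chain_gf:
  fixes p q :: "'a::field"
  assumes n: "n \<ge> 1"
  shows "G n p q = fps_const (p * q) * (\<Sum>u\<in>updown_perms n. chain_gf p q (u 1) (Ret1 n u) n)"
proof (rule fps_ext)
  fix m
  show "G n p q $ m = (fps_const (p * q) * (\<Sum>u\<in>updown_perms n. chain_gf p q (u 1) (Ret1 n u) n)) $ m"
  proof (cases "m = 0")
    case True
    then show ?thesis by (simp add: G_def chain_gf_def fps_sum_nth)
  next
    case False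
    let ?A = "\<lambda>u. {f \<in> {1..n} \<rightarrow>\<^sub>E {1..m}. sorted_by n u f}"
    let ?w = "\<lambda>f. p ^ f 1 * q ^ (m + 1 - f 1) :: 'a"
    have "G n p q $ m = (\<Sum>f\<in>(\<Union>u\<in>updown_perms n. ?A u). ?w f)"
      using n False by (simp add: G_def Omega_def relaxed_partitions_eq_UN)
    also have "\<dots> = (\<Sum>u\<in>updown_perms n. \<Sum>f\<in>?A u. ?w f)"
    proof (rule sum.UNION_disjoint)
      show "\<forall>u\<in>updown_perms n. finite (?A u)"
        by (auto intro!: finite_subset[of "?A _" "{1..n} \<rightarrow>\<^sub>E {1..m}"] finite_PiE)
      show "\<forall>u\<in>updown_perms n. \<forall>v\<in>updown_perms n. u \<noteq> v \<longrightarrow> ?A u \<inter> ?A v = {}"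
        using sorted_by_unique updown_permsD(1) by blast
    qed (rule finite_updown_perms)
    also have "\<dots> = (\<Sum>u\<in>updown_perms n. p * q * chain_gf p q (u 1) (Ret1 n u) n $ m)"
    proof (rule sum.cong[OF refl])
      fix u assume u: "u \<in> updown_perms n"
      then have u1: "u 1 \<in> {1..n}"
        using permutes_in_image[OF updown_permsD(1)[OF u], of 1] n by simp
      have "(\<Sum>f\<in>?A u. ?w f) = (\<Sum>a\<in>gap_chains (Ret1 n u) n m. ?w (a \<circ> u))"
        by (rule sum.reindex_bij_betw[OF bij_betw_gap_chains_sorted_by[OF u n], symmetric])
      also have "\<dots> = (\<Sum>a\<in>gap_chains (Ret1 n u) n m. p * q * chain_weight p q (u 1) n a m)"
      proof (rule sum.cong[OF refl])
        fix a assume "a \<in> gap_chains (Ret1 n u) n m"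
        then have a: "a (u 1) \<in> {1..m}" using u1 by (auto simp: gap_chains_def)
        then obtain c where c: "a (u 1) = Suc c" by (cases "a (u 1)") auto
        \<comment> \<open>Both exponents are positive, so one factor \<open>p\<close> and one factor
          \<open>q\<close> can be pulled out, leaving \<open>chain_weight\<close>.\<close>
        have "m + 1 - Suc c = Suc (m - Suc c)" using a c by auto
        then show "?w (a \<circ> u) = p * q * chain_weight p q (u 1) n a m"
          using u1 c by (simp add: chain_weight_def)
      qed
      finally show "(\<Sum>f\<in>?A u. ?w f) = p * q * chain_gf p q (u 1) (Ret1 n u) n $ m"
        using False by (simp add: chain_gf_def sum_distrib_left)
    qed
    finally show ?thesis by (simp add: fps_sum_nth sum_distrib_left)
  qed
qed

subsection \<open>The recurrence for \<open>U\<close>\<close>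

text \<open>The function \<open>U\<close> with denominators cleared by \<open>(1 - s) ^ n\<close>.
  Being a polynomial expression, it makes sense in any commutative ring and commutes with ring
  homomorphisms, so it passes between power series, polynomials and the field.\<close>

definition U_num :: "nat \<Rightarrow> 'a::comm_ring_1 \<Rightarrow> 'a \<Rightarrow> 'a" where
  "U_num n s t =
     (if n = 0 then 1
      else \<Sum>u\<in>updown_perms n.
             s ^ ret1_minus n u * t ^ ret1_plus n u * ((1 - s) ^ (n - u 1) * (1 - t) ^ u 1))"

lemma updown_perms_first:
  assumes "u \<in> updown_perms n" "n \<ge> 1"
  shows "1 \<le> u 1" "u 1 \<le> n"
  using permutes_in_image[OF updown_permsD(1)[OF assms(1)], of 1] assms(2) by auto

lemma U_num_eq:
  fixes s t :: "'a::field"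
  assumes "s \<noteq> 1"
  shows "U_num n s t = (1 - s) ^ n * U n s t"
proof (cases "n = 0")
  case False
  have "(1 - s) ^ (n - u 1) * (1 - t) ^ u 1 = (1 - s) ^ n * ((1 - t) / (1 - s)) ^ u 1"
    if "u \<in> updown_perms n" for u
    using updown_perms_first[OF that] False assms by (simp add: power_diff power_divide)
  then show ?thesis
    using False by (auto simp: U_num_def U_def sum_distrib_left mult_ac intro!: sum.cong)
qed (simp add: U_num_def U_def)

lemma fps_of_poly_U_num:
  fixes a b :: "'a::field poly"
  shows "fps_of_poly (U_num n a b) = U_num n (fps_of_poly a) (fps_of_poly b)"
  by (simp add: U_num_def fps_of_poly_sum fps_of_poly_mult fps_of_poly_power fps_of_poly_diff)

lemma poly_U_num:
  fixes a b :: "'a::field poly"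
  shows "poly (U_num n a b) x = U_num n (poly a x) (poly b x)"
  by (simp add: U_num_def poly_sum)

text \<open>The value \<open>u 1\<close> sits at position 1 and so cannot be a big return; moving it
  from one interval to the other changes no count.\<close>

lemma Ret1_cards:
  assumes u: "u \<in> updown_perms n" and n: "n \<ge> 1"
  shows "card (Ret1 n u \<inter> {1..<u 1}) = ret1_minus n u"
    and "card (Ret1 n u \<inter> {u 1..n}) = ret1_plus n u"
proof -
  have "inv u (u 1) = 1"
    using permutes_inverses(2)[OF updown_permsD(1)[OF u]] by simp
  then have "u 1 \<notin> Ret1 n u" by (auto simp: Ret1_def)
  moreover have "n \<notin> Ret1 n u" using n by (auto simp: Ret1_def)
  ultimately have "Ret1 n u \<inter> {1..<u 1} = Ret1 n u \<inter> {1..u 1}"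
    "Ret1 n u \<inter> {u 1..n} = Ret1 n u \<inter> {u 1 + 1..n - 1}"
    by (force simp: le_less)+
  then show "card (Ret1 n u \<inter> {1..<u 1}) = ret1_minus n u"
    and "card (Ret1 n u \<inter> {u 1..n}) = ret1_plus n u"
    by (simp_all only: ret1_minus_def ret1_plus_def)
qed

lemma G_eq_U_num:
  fixes p q :: "'a::field"
  defines "s \<equiv> fps_const p * fps_X" and "t \<equiv> fps_const q * fps_X"
  shows "G n p q * ((1 - s) ^ n * (1 - t) ^ (n + 1)) = fps_const (p * q) * fps_X * U_num n s t"
proof (cases "n = 0")
  case True
  then show ?thesis
    by (simp add: G_def U_num_def fps_divide_unit mult.assoc inverse_mult_eq_1 t_def)
next
  case False
  then have n: "n \<ge> 1" by simp
  have "chain_gf p q (u 1) (Ret1 n u) n * ((1 - s) ^ n * (1 - t) ^ (n + 1)) =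
      fps_X * (s ^ ret1_minus n u * t ^ ret1_plus n u * ((1 - s) ^ (n - u 1) * (1 - t) ^ u 1))"
    if u: "u \<in> updown_perms n" for u
  proof -
    note k = updown_perms_first[OF u n]
    \<comment> \<open>The closed form for \<open>u\<close> uses up \<open>u 1\<close> factors
      \<open>1 - s\<close> and \<open>n + 1 - u 1\<close> factors \<open>1 - t\<close>; the surplus
      is the last factor in \<open>U_num\<close>.\<close>
    have "(1 - s) ^ n = (1 - s) ^ u 1 * (1 - s) ^ (n - u 1)"
      "(1 - t) ^ (n + 1) = (1 - t) ^ (n + 1 - u 1) * (1 - t) ^ u 1"
      using k by (simp_all flip: power_add)
    then have "chain_gf p q (u 1) (Ret1 n u) n * ((1 - s) ^ n * (1 - t) ^ (n + 1)) =
        (chain_gf p q (u 1) (Ret1 n u) n * ((1 - s) ^ u 1 * (1 - t) ^ (n + 1 - u 1))) *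
        ((1 - s) ^ (n - u 1) * (1 - t) ^ u 1)"
      by (simp only: mult_ac)
    then show ?thesis
      unfolding s_def t_def chain_gf_closed_form[OF k] Ret1_cards[OF u n] by (simp only: mult_ac)
  qed
  then show ?thesis
    using False unfolding G_eq_sum_chain_gf[OF n] U_num_def
    by (simp add: sum_distrib_left sum_distrib_right mult.assoc cong: sum.cong)
qed

text \<open>The recurrence for \<^const>\<open>G\<close> translates into an identity of polynomials in \<open>X\<close>, where, unlike
  in the power series ring, one may put \<open>X = 1\<close>.\<close>

lemma U_num_Suc:
  fixes p q :: "'a::field"
  assumes "p \<noteq> q" "p \<noteq> 0" "q \<noteq> 0"
  shows "(p - q) * (1 - q) ^ n * U_num (n + 1) p q =
    (1 - q) ^ (n + 2) * p * U_num n q p - (1 - p) ^ (n + 1) * (1 - q) * q * U_num n q q"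
proof -
  define s t where "s = fps_const p * fps_X" and "t = fps_const q * fps_X"
  define c where "c = fps_const (p * q) * fps_X"
  let ?G1 = "G (n + 1) p q" and ?G2 = "G n q p" and ?G3 = "G n q q"
  have g1: "?G1 * ((1 - s) ^ (n + 1) * (1 - t) ^ (n + 2)) = c * U_num (n + 1) s t"
    using G_eq_U_num[of "n + 1" p q] by (simp add: s_def t_def c_def)
  have g2: "?G2 * ((1 - t) ^ n * (1 - s) ^ (n + 1)) = c * U_num n t s"
    using G_eq_U_num[of n q p] by (simp add: s_def t_def c_def mult.commute[of q p])
  \<comment> \<open>The prefactor for \<open>?G3\<close> is built from \<open>q * q\<close>; the
    additional \<open>p\<close> brings out the common \<open>c\<close>.\<close>
  have g3: "fps_const p * (?G3 * ((1 - t) ^ n * (1 - t) ^ (n + 1))) = fps_const q * c * U_num n t t"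
    using G_eq_U_num[of n q q] by (simp add: t_def c_def mult_ac flip: fps_const_mult)
  have g: "fps_const (p - q) * ?G1 = fps_const p * (?G2 - ?G3)"
    using G_Suc[OF assms(1), of n] assms(1) by (simp add: mult.assoc[symmetric])
  \<comment> \<open>The extra \<open>(1 - t) ^ n\<close> provides a common denominator for
    \<open>?G1\<close>, \<open>?G2\<close> and \<open>?G3\<close>.\<close>
  have "c * (fps_const (p - q) * (1 - t) ^ n * U_num (n + 1) s t) =
      fps_const (p - q) * ?G1 * ((1 - s) ^ (n + 1) * (1 - t) ^ (n + 2) * (1 - t) ^ n)"
    using g1 by (simp only: mult_ac)
  also have "\<dots> = (1 - t) ^ (n + 2) * fps_const p * (?G2 * ((1 - t) ^ n * (1 - s) ^ (n + 1))) -
      (1 - s) ^ (n + 1) * (1 - t) * (fps_const p * (?G3 * ((1 - t) ^ n * (1 - t) ^ (n + 1))))"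
    unfolding g by (simp add: algebra_simps)
  also have "\<dots> = c * ((1 - t) ^ (n + 2) * fps_const p * U_num n t s -
      (1 - s) ^ (n + 1) * (1 - t) * fps_const q * U_num n t t)"
    unfolding g2 g3 by (simp only: right_diff_distrib mult_ac)
  finally have "fps_const (p - q) * (1 - t) ^ n * U_num (n + 1) s t =
      (1 - t) ^ (n + 2) * fps_const p * U_num n t s -
      (1 - s) ^ (n + 1) * (1 - t) * fps_const q * U_num n t t"
    using assms by (simp add: c_def)
  \<comment> \<open>Both sides are images of polynomials, and \<open>fps_of_poly\<close> is
    injective, so the identity descends to polynomials.\<close>
  moreover have "s = fps_of_poly [:0, p:]" "t = fps_of_poly [:0, q:]"
    by (simp_all add: s_def t_def fps_of_poly_pCons mult.commute)
  ultimately have "fps_of_poly ([:p - q:] * (1 - [:0, q:]) ^ n * U_num (n + 1) [:0, p:] [:0, q:]) =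
      fps_of_poly ((1 - [:0, q:]) ^ (n + 2) * [:p:] * U_num n [:0, q:] [:0, p:] -
      (1 - [:0, p:]) ^ (n + 1) * (1 - [:0, q:]) * [:q:] * U_num n [:0, q:] [:0, q:])"
    by (simp only: fps_of_poly_mult fps_of_poly_diff fps_of_poly_power fps_of_poly_U_num
        fps_of_poly_1 fps_of_poly_const)
  then have "poly ([:p - q:] * (1 - [:0, q:]) ^ n * U_num (n + 1) [:0, p:] [:0, q:]) 1 =
      poly ((1 - [:0, q:]) ^ (n + 2) * [:p:] * U_num n [:0, q:] [:0, p:] -
      (1 - [:0, p:]) ^ (n + 1) * (1 - [:0, q:]) * [:q:] * U_num n [:0, q:] [:0, q:]) 1"
    by (simp only: fps_of_poly_eq_iff)
  then show ?thesis
    by (simp add: poly_U_num mult_ac del: power_Suc)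
qed

theorem U_Suc:
  fixes s t :: "'a::field"
  assumes "s \<noteq> t" "s \<noteq> 0" "t \<noteq> 0" "s \<noteq> 1" "t \<noteq> 1"
  shows "U (n + 1) s t =
    (1 - t) / (s - t) * (((1 - t) / (1 - s)) ^ (n + 1) * s * U n t s - t * U n t t)"
proof -
  define a b where "a = 1 - s" and "b = 1 - t"
  have nz: "a \<noteq> 0" "b \<noteq> 0" "s - t \<noteq> 0" using assms by (auto simp: a_def b_def)
  \<comment> \<open>Kept opaque, \<open>r\<close> enters only through the division-free relation
    below until the common factor \<open>b ^ n * a ^ (n + 1)\<close> is cancelled.\<close>
  define r where "r = (b / a) ^ (n + 1)"
  have r: "a ^ (n + 1) * r = b ^ (n + 1)" using nz by (simp add: r_def power_divide)
  have "(b ^ n * a ^ (n + 1)) * ((s - t) * U (n + 1) s t) =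
      b ^ n * (b ^ (n + 1) * (b * s * U n t s) - a ^ (n + 1) * (b * t * U n t t))"
    using U_num_Suc[OF assms(1,2,3), of n]
    by (simp add: U_num_eq assms a_def[symmetric] b_def[symmetric] algebra_simps)
  also have "\<dots> = (b ^ n * a ^ (n + 1)) * (b * (r * s * U n t s - t * U n t t))"
    unfolding r[symmetric] by (simp only: right_diff_distrib mult_ac)
  finally have "(b ^ n * a ^ (n + 1)) * ((s - t) * U (n + 1) s t) =
      (b ^ n * a ^ (n + 1)) * (b * ((b / a) ^ (n + 1) * s * U n t s - t * U n t t))"
    by (simp only: r_def)
  then have "(s - t) * U (n + 1) s t = b * ((b / a) ^ (n + 1) * s * U n t s - t * U n t t)"
    using nz by simp
  then show ?thesis
    using nz by (simp add: a_def[symmetric] b_def[symmetric] eq_divide_eq mult.commute)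
qed

section \<open>Specialisation to the indeterminates\<close>

lemma indets_distinct:
  "indet1 \<noteq> indet2" "indet1 \<noteq> 0" "indet2 \<noteq> 0" "indet1 \<noteq> 1" "indet2 \<noteq> 1"
  by (simp_all add: indet1_def indet2_def flip: to_fract_0 to_fract_1) (simp_all add: one_pCons)

theorem theorem1p1:
  fixes n :: nat and p q s t :: ratfun2
  assumes "p = indet1" and "q = indet2" and "s = indet1" and "t = indet2"
  shows "G (n + 1) p q = fps_const (p / (p - q)) * (G n q p - G n q q) \<and>
         U (n + 1) s t =
           (1 - t) / (s - t) * (((1 - t) / (1 - s)) ^ (n + 1) * s * U n t s - t * U n t t)"
  using G_Suc[of p q n] U_Suc[of s t n] indets_distinct unfolding assms by blast

end
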